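(* For all positive integers $m,n,k$ with $n\ge m+k$ and every integer $r\ge 0$, \[ \binom{m+k}{m}L_{2r}(n,m+k)=\sum_{l=m}^{n-k}\binom{n}{l}L_{r}(l,m)\,L_{r}(n-l,k). \]
   Context: For a nonnegative integer $r$ and integers $0\le k\le n$, the $r$-Lah number $L_r(n,k)$ is the number of partitions of a set with $n+r$ elements into $k+r$ non-empty linearly ordered subsets such that $r$ distinguished elements lie in distinct subsets; equivalently $L_r(n,k)=\frac{n!}{k!}\binom{n+2r-1}{k+2r-1}$, with exponential generating function $\sum_{n\ge k}L_r(n,k)\frac{t^n}{n!}=\frac{1}{k!}\left(\frac{1}{1-t}-1\right)^k\left(\frac{1}{1-t}\right)^{2r}$. *)

theory Defs
  imports Main "HOL-Library.Disjoint_Sets"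
begin

text \<open>
  A linearly ordered non-empty subset is encoded as the non-empty list without repetitions that
  enumerates it in increasing order.  A partition of \<open>A\<close> into such subsets is then a set \<open>P\<close> of
  lists whose underlying sets partition \<open>A\<close>. Injectivity of \<open>set\<close> on \<open>P\<close> says that every block
  carries just one order; \<^const>\<open>partition_on\<close> excludes the empty block.
\<close>

definition ordered_partitions :: "'a set \<Rightarrow> 'a set \<Rightarrow> nat \<Rightarrow> 'a list set set" where
  "ordered_partitions A D j =
     {P. partition_on A (set ` P) \<and> inj_on set P \<and> (\<forall>xs\<in>P. distinct xs) \<and> card P = j \<and>
         (\<forall>xs\<in>P. \<forall>x\<in>D. \<forall>y\<in>D. x \<in> set xs \<and> y \<in> set xs \<longrightarrow> x = y)}"

text \<open>The ground set is \<open>{0, \<dots>, n + r - 1}\<close>, with distinguished elements \<open>0, \<dots>, r - 1\<close>.\<close>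

definition r_Lah :: "nat \<Rightarrow> nat \<Rightarrow> nat \<Rightarrow> nat" where
  "r_Lah r n k = card (ordered_partitions {..<n + r} {..<r} (k + r))"

end

theory Submission
  imports Defs
begin

text \<open>
  Double counting.  Split the \<open>2r\<close> distinguished elements into two halves \<open>D\<close> and \<open>E\<close>, and choose
  \<open>m\<close> of the \<open>m + k\<close> blocks of an ordered partition that contain no distinguished element.  The
  chosen blocks and the blocks meeting \<open>D\<close> form an ordered partition of \<open>D \<union> X\<close>, the others one of
  \<open>E \<union> (N - X)\<close>, where \<open>X\<close> is a subset of the set \<open>N\<close> of non-distinguished elements; and
  every such pair of ordered partitions arises exactly once.
\<close>

section \<open>Elementwise description of ordered partitions\<close>

lemma ordered_partitions_iff:
  "P \<in> ordered_partitions A D j \<longleftrightarrow>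
     (\<Union>xs\<in>P. set xs) = A \<and> [] \<notin> P \<and> (\<forall>xs\<in>P. distinct xs) \<and> card P = j \<and>
     (\<forall>xs\<in>P. \<forall>ys\<in>P. \<forall>x. x \<in> set xs \<and> x \<in> set ys \<longrightarrow> xs = ys) \<and>
     (\<forall>xs\<in>P. \<forall>x\<in>D. \<forall>y\<in>D. x \<in> set xs \<and> y \<in> set xs \<longrightarrow> x = y)"
proof -
  \<comment> \<open>Disjointness of the underlying sets and injectivity of \<open>set\<close> merge
    into one condition: lists of \<open>P\<close> that share an element are equal.\<close>
  have "partition_on A (set ` P) \<and> inj_on set P \<longleftrightarrow>
      (\<Union>xs\<in>P. set xs) = A \<and> [] \<notin> P \<and>
      (\<forall>xs\<in>P. \<forall>ys\<in>P. \<forall>x. x \<in> set xs \<and> x \<in> set ys \<longrightarrow> xs = ys)" (is "?L \<longleftrightarrow> ?R")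
  proof
    assume L: ?L
    have "xs = ys" if "xs \<in> P" "ys \<in> P" "x \<in> set xs" "x \<in> set ys" for xs ys x
    proof -
      have "set xs = set ys"
        using L that unfolding partition_on_def disjoint_def by blast
      then show ?thesis
        using L that by (auto dest: inj_onD)
    qed
    moreover have "[] \<notin> P"
      using L by (auto simp: partition_on_def)
    ultimately show ?R
      using L by (auto simp: partition_on_def)
  next
    assume R: ?R
    have "inj_on set P"
    proof (rule inj_onI)
      fix xs ys assume *: "xs \<in> P" "ys \<in> P" "set xs = set ys"
      \<comment> \<open>As no list is empty, two lists with the same underlying set do share an
        element, for instance the head.\<close>
      then have "hd xs \<in> set xs"
        using R by (metis hd_in_set)
      then show "xs = ys"
        using R * by metis
    qed
    moreover have "disjoint (set ` P)"
      unfolding disjoint_def using R by blast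
    ultimately show ?L
      using R by (auto simp: partition_on_def)
  qed
  then show ?thesis
    unfolding ordered_partitions_def by auto
qed

lemma ordered_partitions_block_unique:
  assumes "P \<in> ordered_partitions A D j" "xs \<in> P" "ys \<in> P" "x \<in> set xs" "x \<in> set ys"
  shows "xs = ys"
  using assms by (simp add: ordered_partitions_iff) blast

lemma ordered_partitions_separates:
  assumes "P \<in> ordered_partitions A D j" "xs \<in> P" "x \<in> D" "y \<in> D" "x \<in> set xs" "y \<in> set xs"
  shows "x = y"
  using assms by (simp add: ordered_partitions_iff)

lemma ordered_partitions_hd_in_set:
  assumes "P \<in> ordered_partitions A D j" "xs \<in> P"
  shows "hd xs \<in> set xs"
  using assms by (intro hd_in_set) (auto simp: ordered_partitions_iff)

lemma ordered_partitions_Union: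
  assumes "P \<in> ordered_partitions A D j"
  shows "(\<Union>xs\<in>P. set xs) = A"
  using assms by (simp add: ordered_partitions_iff)

lemma ordered_partitionsI:
  assumes "(\<Union>xs\<in>P. set xs) = A" "[] \<notin> P" "\<And>xs. xs \<in> P \<Longrightarrow> distinct xs" "card P = j"
    and "\<And>xs ys x. xs \<in> P \<Longrightarrow> ys \<in> P \<Longrightarrow> x \<in> set xs \<Longrightarrow> x \<in> set ys \<Longrightarrow> xs = ys"
    and "\<And>xs x y. xs \<in> P \<Longrightarrow> x \<in> D \<Longrightarrow> y \<in> D \<Longrightarrow> x \<in> set xs \<Longrightarrow> y \<in> set xs \<Longrightarrow> x = y"
  shows "P \<in> ordered_partitions A D j"
  unfolding ordered_partitions_iff using assms by (intro conjI ballI allI impI) blast+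

section \<open>Finiteness and invariance under relabelling\<close>

lemma ordered_partitions_subset:
  "ordered_partitions A D j \<subseteq> Pow {xs. set xs \<subseteq> A \<and> distinct xs}"
  by (auto simp: ordered_partitions_iff)

lemma finite_ordered_partitions:
  assumes "finite A"
  shows "finite (ordered_partitions A D j)"
  using ordered_partitions_subset finite_subset_distinct[OF assms]
  by (rule finite_subset[OF _ finite_Pow_iff[THEN iffD2]])

lemma finite_ordered_partition:
  assumes "finite A" "P \<in> ordered_partitions A D j"
  shows "finite P"
  using assms ordered_partitions_subset[of A D j] finite_subset_distinct[OF assms(1)]
  by (meson PowD finite_subset subsetD)

text \<open>Renaming all entries by \<open>f\<close> is injective on ordered partitions. An
  inequality is enough here: used in both directions it gives equality, so the renaming never has to
  be inverted.\<close>

lemma card_ordered_partitions_le: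
  assumes A: "finite A" and f: "inj_on f A" and D: "D \<subseteq> A"
  shows "card (ordered_partitions A D j) \<le> card (ordered_partitions (f ` A) (f ` D) j)"
proof (rule card_inj_on_le[where f = "image (map f)"])
  \<comment> \<open>Injectivity is lifted twice: from \<open>f\<close> to \<open>map f\<close> on
    lists over \<open>A\<close>, then to images of sets of such lists.\<close>
  have inj: "inj_on (map f) {xs. set xs \<subseteq> A \<and> distinct xs}"
    by (rule inj_onI) (auto intro!: map_inj_on[of f] inj_on_subset[OF f])
  show "inj_on (image (map f)) (ordered_partitions A D j)"
    using inj_on_subset[OF inj_on_image_Pow[OF inj] ordered_partitions_subset] .
  show "image (map f) ` ordered_partitions A D j \<subseteq> ordered_partitions (f ` A) (f ` D) j"
  proof (rule image_subsetI)
    fix P assume P: "P \<in> ordered_partitions A D j"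
    then have PA: "P \<subseteq> {xs. set xs \<subseteq> A \<and> distinct xs}"
      using ordered_partitions_subset by blast
    \<comment> \<open>Membership pulls back along \<open>f\<close>, which reduces each condition on
      renamed blocks to the same condition on \<open>P\<close>.\<close>
    have *: "y \<in> set xs" if "f y \<in> f ` set xs" "xs \<in> P" "y \<in> A" for xs y
      using that PA f inj_on_image_mem_iff[OF f, of y "set xs"] by auto
    show "map f ` P \<in> ordered_partitions (f ` A) (f ` D) j"
    proof (rule ordered_partitionsI)
      show "card (map f ` P) = j"
        using card_image[OF inj_on_subset[OF inj PA]] P by (simp add: ordered_partitions_iff)
      show "(\<Union>xs\<in>map f ` P. set xs) = f ` A"
        using P by (auto simp: ordered_partitions_iff)
      show "[] \<notin> map f ` P"
        using P by (auto simp: ordered_partitions_iff)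
    next
      fix xs' assume "xs' \<in> map f ` P"
      then show "distinct xs'"
        using PA by (force simp: distinct_map intro: inj_on_subset[OF f])
    next
      fix xs' ys' x'
      assume "xs' \<in> map f ` P" "ys' \<in> map f ` P" "x' \<in> set xs'" "x' \<in> set ys'"
      then obtain xs ys x where xs: "xs' = map f xs" "xs \<in> P" and ys: "ys' = map f ys" "ys \<in> P"
        and x: "x' = f x" "x \<in> set xs" "f x \<in> f ` set ys"
        by force
      have "x \<in> set ys"
        using * x ys xs PA by blast
      then show "xs' = ys'"
        using ordered_partitions_block_unique[OF P] xs ys x by blast
    next
      fix xs' x' y'
      assume "xs' \<in> map f ` P" "x' \<in> f ` D" "y' \<in> f ` D" "x' \<in> set xs'" "y' \<in> set xs'"
      then obtain xs x y where xs: "xs \<in> P" and x: "x' = f x" "x \<in> D" "f x \<in> f ` set xs"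
        and y: "y' = f y" "y \<in> D" "f y \<in> f ` set xs"
        by force
      have "x \<in> set xs" "y \<in> set xs"
        using * x y xs D by blast+
      then show "x' = y'"
        using ordered_partitions_separates[OF P] xs x y by blast
    qed
  qed
  show "finite (ordered_partitions (f ` A) (f ` D) j)"
    using A by (simp add: finite_ordered_partitions)
qed

text \<open>A bijection from \<open>D\<close> to \<open>E\<close> and one between the complements
  combine to a renaming that respects distinguished elements. This frees \<open>r_Lah\<close> from
  its concrete ground set.\<close>

lemma card_ordered_partitions_cong:
  assumes A: "finite A" "D \<subseteq> A" and B: "finite B" "E \<subseteq> B"
    and "card A = card B" "card D = card E"
  shows "card (ordered_partitions A D j) = card (ordered_partitions B E j)"
proof -
  \<comment> \<open>Fresh type variables allow the inequality to be used in both directions even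
    when the two ground sets have different types.\<close>
  have le: "card (ordered_partitions A D j) \<le> card (ordered_partitions B E j)"
    if "finite A" "D \<subseteq> A" "finite B" "E \<subseteq> B" "card A = card B" "card D = card E"
    for A D :: "'c set" and B E :: "'d set"
  proof -
    have fin: "finite D" "finite E"
      using that finite_subset by auto
    have "card (A - D) = card (B - E)"
      using that fin by (simp add: card_Diff_subset)
    then obtain g where g: "bij_betw g (A - D) (B - E)"
      using finite_same_card_bij[of "A - D" "B - E"] \<open>finite A\<close> \<open>finite B\<close> by auto
    obtain f where f: "bij_betw f D E"
      using finite_same_card_bij[of D E] fin \<open>card D = card E\<close> by auto
    define h where "h x = (if x \<in> D then f x else g x)" for x
    have hD: "bij_betw h D E" using f by (rule bij_betw_cong[THEN iffD1, rotated]) (simp add: h_def)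
    moreover have "bij_betw h (A - D) (B - E)"
      using g by (rule bij_betw_cong[THEN iffD1, rotated]) (simp add: h_def)
    ultimately have "bij_betw h (D \<union> (A - D)) (E \<union> (B - E))"
      by (rule bij_betw_combine) auto
    then have "bij_betw h A B"
      using that by (simp add: Un_absorb1)
    then show ?thesis
      using card_ordered_partitions_le[of A h D j] hD that by (simp add: bij_betw_def)
  qed
  show ?thesis
    using le[of A D B E] le[of B E A D] assms by simp
qed

lemma r_Lah_eq_card_ordered_partitions:
  assumes "finite D" "finite X" "D \<inter> X = {}"
  shows "card (ordered_partitions (D \<union> X) D (k + card D)) = r_Lah (card D) (card X) k"
  unfolding r_Lah_def
  by (rule card_ordered_partitions_cong) (use assms in \<open>auto simp: card_Un_disjoint\<close>)

text \<open>The heads of the blocks are distinct elements of the ground set, so there are at most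
  \<open>n + r\<close> blocks. This later trims the range of summation.\<close>

lemma r_Lah_eq_0:
  assumes "n < k"
  shows "r_Lah r n k = 0"
proof -
  have "P \<notin> ordered_partitions {..<n + r} {..<r} (k + r)" for P
  proof
    assume P: "P \<in> ordered_partitions {..<n + r} {..<r} (k + r)"
    note hd = ordered_partitions_hd_in_set[OF P]
    have "inj_on hd P"
      by (rule inj_onI) (metis hd ordered_partitions_block_unique[OF P])
    moreover have "hd ` P \<subseteq> {..<n + r}"
      using ordered_partitions_Union[OF P] hd by blast
    ultimately have "card P \<le> n + r"
      using card_inj_on_le[of hd P "{..<n + r}"] by simp
    then show False
      using P assms by (simp add: ordered_partitions_iff)
  qed
  then have "ordered_partitions {..<n + r} {..<r} (k + r) = {}"
    by blast
  then show ?thesis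
    by (simp add: r_Lah_def)
qed

section \<open>Choosing blocks of a given ordered partition\<close>

lemma card_blocks_meeting:
  assumes P: "P \<in> ordered_partitions A D j" and "D \<subseteq> A" "E \<subseteq> D"
  shows "card {xs \<in> P. set xs \<inter> E \<noteq> {}} = card E"
proof -
  have "\<forall>x\<in>E. \<exists>xs\<in>P. x \<in> set xs"
    using ordered_partitions_Union[OF P] \<open>D \<subseteq> A\<close> \<open>E \<subseteq> D\<close> by blast
  \<comment> \<open>\<open>g\<close> sends an element to its block. It is injective because no block
    holds two elements of \<open>D\<close>, and it hits every block meeting \<open>E\<close> because
    blocks sharing an element are equal.\<close>
  then obtain g where g: "\<And>x. x \<in> E \<Longrightarrow> g x \<in> P \<and> x \<in> set (g x)"
    by metis
  have "inj_on g E"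
    by (rule inj_onI) (metis g ordered_partitions_separates[OF P] \<open>E \<subseteq> D\<close> subsetD)
  moreover have "g ` E = {xs \<in> P. set xs \<inter> E \<noteq> {}}"
  proof (intro equalityI subsetI)
    fix xs assume xs: "xs \<in> {xs \<in> P. set xs \<inter> E \<noteq> {}}"
    then obtain x where x: "x \<in> set xs" "x \<in> E" by auto
    then have "g x = xs"
      using g[of x] xs ordered_partitions_block_unique[OF P] by blast
    then show "xs \<in> g ` E" using x by auto
  qed (use g in blast)
  ultimately show ?thesis
    by (metis card_image)
qed

text \<open>The members of \<open>M\<close> are forced in and those of \<open>M'\<close> are forced
  out, so only \<open>m\<close> of the other \<open>m + k\<close> members remain to be chosen. In
  the application these are the blocks meeting \<open>D\<close> and \<open>E\<close>.\<close>

lemma card_intermediate_subsets: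
  assumes "finite P" "M \<subseteq> P" "M' \<subseteq> P" "M \<inter> M' = {}"
    and "card P = m + k + card M + card M'"
  shows "card {Q. M \<subseteq> Q \<and> Q \<subseteq> P - M' \<and> card Q = m + card M} = (m + k) choose m"
proof -
  let ?F = "P - M - M'"
  have fin: "finite M" "finite M'"
    using assms(1-3) by (auto intro: finite_subset)
  have "bij_betw (\<lambda>S. M \<union> S) {S. S \<subseteq> ?F \<and> card S = m}
          {Q. M \<subseteq> Q \<and> Q \<subseteq> P - M' \<and> card Q = m + card M}"
  proof (rule bij_betw_byWitness[where f' = "\<lambda>Q. Q - M"])
    show "(\<lambda>S. M \<union> S) ` {S. S \<subseteq> ?F \<and> card S = m}
        \<subseteq> {Q. M \<subseteq> Q \<and> Q \<subseteq> P - M' \<and> card Q = m + card M}"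
    proof (rule image_subsetI)
      fix S assume S: "S \<in> {S. S \<subseteq> ?F \<and> card S = m}"
      then have "finite S" using assms(1) by (auto intro: finite_subset)
      then have "card (M \<union> S) = card M + card S"
        using S fin by (intro card_Un_disjoint) auto
      then show "M \<union> S \<in> {Q. M \<subseteq> Q \<and> Q \<subseteq> P - M' \<and> card Q = m + card M}"
        using S assms by auto
    qed
    show "(\<lambda>Q. Q - M) ` {Q. M \<subseteq> Q \<and> Q \<subseteq> P - M' \<and> card Q = m + card M}
        \<subseteq> {S. S \<subseteq> ?F \<and> card S = m}"
      using fin by (auto simp: card_Diff_subset)
    show "\<forall>S\<in>{S. S \<subseteq> ?F \<and> card S = m}. M \<union> S - M = S"
      by blast
    show "\<forall>Q\<in>{Q. M \<subseteq> Q \<and> Q \<subseteq> P - M' \<and> card Q = m + card M}. M \<union> (Q - M) = Q"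
      by blast
  qed
  then have "card {Q. M \<subseteq> Q \<and> Q \<subseteq> P - M' \<and> card Q = m + card M}
      = card {S. S \<subseteq> ?F \<and> card S = m}"
    by (rule bij_betw_same_card[symmetric])
  moreover have "M' \<subseteq> P - M"
    using assms by blast
  then have "card ?F = m + k"
    using assms fin by (simp add: card_Diff_subset)
  ultimately show ?thesis
    using n_subsets[of ?F m] assms(1) by simp
qed

section \<open>Gluing and splitting ordered partitions\<close>

lemma ordered_partitions_Un:
  assumes P: "P \<in> ordered_partitions A D i" and Q: "Q \<in> ordered_partitions B E j"
    and "finite A" "finite B" "D \<subseteq> A" "E \<subseteq> B" "A \<inter> B = {}"
  shows "P \<inter> Q = {}" "P \<union> Q \<in> ordered_partitions (A \<union> B) (D \<union> E) (i + j)"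
proof -
  have P': "xs \<noteq> []" "set xs \<subseteq> A" if "xs \<in> P" for xs
    using P that by (auto simp: ordered_partitions_iff)
  have Q': "xs \<noteq> []" "set xs \<subseteq> B" if "xs \<in> Q" for xs
    using Q that by (auto simp: ordered_partitions_iff)
  show disj: "P \<inter> Q = {}"
    using P' Q' \<open>A \<inter> B = {}\<close> by (metis disjoint_iff list.set_intros(1) list.exhaust subsetD)
  show "P \<union> Q \<in> ordered_partitions (A \<union> B) (D \<union> E) (i + j)"
  proof (rule ordered_partitionsI)
    show "card (P \<union> Q) = i + j"
      using card_Un_disjoint[OF finite_ordered_partition[OF _ P] finite_ordered_partition[OF _ Q] disj]
        P Q \<open>finite A\<close> \<open>finite B\<close> by (simp add: ordered_partitions_iff)
    show "(\<Union>xs\<in>P \<union> Q. set xs) = A \<union> B"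
      using ordered_partitions_Union[OF P] ordered_partitions_Union[OF Q] by (simp add: UN_Un)
    show "[] \<notin> P \<union> Q"
      using P' Q' by blast
  next
    fix xs assume "xs \<in> P \<union> Q"
    then show "distinct xs"
      using P Q by (auto simp: ordered_partitions_iff)
  next
    fix xs ys x assume *: "xs \<in> P \<union> Q" "ys \<in> P \<union> Q" "x \<in> set xs" "x \<in> set ys"
    \<comment> \<open>A common element lies in only one of \<open>A\<close> and \<open>B\<close>, so
      both lists come from the same side.\<close>
    have "xs \<in> P \<and> ys \<in> P \<or> xs \<in> Q \<and> ys \<in> Q"
      using * P'(2)[of xs] P'(2)[of ys] Q'(2)[of xs] Q'(2)[of ys] \<open>A \<inter> B = {}\<close> by blast
    then show "xs = ys"
      using * ordered_partitions_block_unique[OF P] ordered_partitions_block_unique[OF Q] by blast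
  next
    fix xs x y
    assume *: "xs \<in> P \<union> Q" "x \<in> D \<union> E" "y \<in> D \<union> E" "x \<in> set xs" "y \<in> set xs"
    have "xs \<in> P \<and> x \<in> D \<and> y \<in> D \<or> xs \<in> Q \<and> x \<in> E \<and> y \<in> E"
      using * P'(2)[of xs] Q'(2)[of xs] \<open>A \<inter> B = {}\<close> \<open>D \<subseteq> A\<close> \<open>E \<subseteq> B\<close> by blast
    then show "x = y"
      using * ordered_partitions_separates[OF P] ordered_partitions_separates[OF Q] by blast
  qed
qed

lemma ordered_partitions_mono:
  assumes "P \<in> ordered_partitions A D j" "Q \<subseteq> P" "E \<subseteq> D"
  shows "Q \<in> ordered_partitions (\<Union>xs\<in>Q. set xs) E (card Q)"
  using assms unfolding ordered_partitions_iff by blast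

text \<open>The pairs in \<open>Sigma OP F\<close> correspond to the triples in
  \<open>Sigma (Pow N) G\<close>. All fibres \<open>F P\<close> have the same size, which yields the
  product on the left; the fibres \<open>G X\<close> yield the sum on the right.\<close>

lemma card_ordered_partitions_split:
  fixes D E N :: "'a set"
  assumes fin: "finite D" "finite E" "finite N"
    and disj: "D \<inter> E = {}" "D \<inter> N = {}" "E \<inter> N = {}"
  shows "((m + k) choose m) *
      card (ordered_partitions (D \<union> E \<union> N) (D \<union> E) (m + k + card D + card E)) =
    (\<Sum>X\<in>Pow N. card (ordered_partitions (D \<union> X) D (m + card D)) *
      card (ordered_partitions (E \<union> (N - X)) E (k + card E)))"
proof -
  define OP where "OP = ordered_partitions (D \<union> E \<union> N) (D \<union> E) (m + k + card D + card E)"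
  define M where "M C P = {xs \<in> P. set xs \<inter> C \<noteq> {}}" for C and P :: "'a list set"
  \<comment> \<open>For \<open>P\<close> in \<open>OP\<close> exactly \<open>card D\<close> blocks
    meet \<open>D\<close>, so the size condition says that \<open>Q\<close> has exactly
    \<open>m\<close> blocks without distinguished elements.\<close>
  define F where "F P = {Q. M D P \<subseteq> Q \<and> Q \<subseteq> P - M E P \<and> card Q = m + card D}" for P
  define G where "G X = ordered_partitions (D \<union> X) D (m + card D) \<times>
    ordered_partitions (E \<union> (N - X)) E (k + card E)" for X
  \<comment> \<open>\<open>f\<close> splits and \<open>g\<close> glues; \<open>X\<close> is
    recovered as what \<open>Q\<close> covers outside \<open>D\<close>.\<close>
  define f where "f = (\<lambda>(P, Q). ((\<Union>xs\<in>Q. set xs) - D, (Q, P - Q :: 'a list set)))"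
  define g where "g = (\<lambda>(X :: 'a set, (Q, R)). (Q \<union> R, Q :: 'a list set))"
  have finP: "finite P" if "P \<in> OP" for P
    using finite_ordered_partition[OF _ that[unfolded OP_def]] fin by simp
  have cardF: "card (F P) = (m + k) choose m" if P: "P \<in> OP" for P
  proof -
    have cM: "card (M D P) = card D" "card (M E P) = card E"
      unfolding M_def using card_blocks_meeting[OF P[unfolded OP_def]] by auto
    have "M D P \<inter> M E P = {}"
      using ordered_partitions_separates[OF P[unfolded OP_def]] disj unfolding M_def by blast
    then show ?thesis
      using card_intermediate_subsets[of P "M D P" "M E P" m k] cM P finP[OF P]
      unfolding F_def by (auto simp: OP_def M_def ordered_partitions_iff)
  qed
  \<comment> \<open>Gluing lands in \<open>Sigma OP F\<close> and loses nothing: \<open>X\<close>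
    and \<open>R\<close> can be read off from \<open>Q\<close> and
    \<open>Q \<union> R\<close>.\<close>
  have Gin: "Q \<union> R \<in> OP \<and> Q \<in> F (Q \<union> R) \<and> Q \<inter> R = {} \<and> (\<Union>xs\<in>Q. set xs) - D = X"
    if X: "X \<subseteq> N" and QR: "(Q, R) \<in> G X" for X Q R
  proof -
    have Q: "Q \<in> ordered_partitions (D \<union> X) D (m + card D)"
      and R: "R \<in> ordered_partitions (E \<union> (N - X)) E (k + card E)"
      using QR by (auto simp: G_def)
    have "finite X" using X fin finite_subset by blast
    note un = ordered_partitions_Un[OF Q R]
    have dis: "(D \<union> X) \<inter> (E \<union> (N - X)) = {}"
      using X disj by blast
    have QR0: "Q \<inter> R = {}"
      using fin \<open>finite X\<close> dis by (intro un(1)) auto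
    have "Q \<union> R \<in> ordered_partitions (D \<union> X \<union> (E \<union> (N - X))) (D \<union> E)
        (m + card D + (k + card E))"
      using fin \<open>finite X\<close> dis by (intro un(2)) auto
    moreover have "D \<union> X \<union> (E \<union> (N - X)) = D \<union> E \<union> N"
      using X by blast
    ultimately have "Q \<union> R \<in> OP"
      by (simp add: OP_def ac_simps)
    moreover have sQ: "set xs \<subseteq> D \<union> X" if "xs \<in> Q" for xs
      using that Q by (auto simp: ordered_partitions_iff)
    have sR: "set xs \<subseteq> E \<union> (N - X)" if "xs \<in> R" for xs
      using that R by (auto simp: ordered_partitions_iff)
    have "M D (Q \<union> R) \<subseteq> Q"
      using sR dis unfolding M_def by blast
    moreover have "Q \<inter> M E (Q \<union> R) = {}"
      using sQ dis unfolding M_def by blast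
    moreover have "card Q = m + card D" "(\<Union>xs\<in>Q. set xs) = D \<union> X"
      using Q by (auto simp: ordered_partitions_iff)
    ultimately show ?thesis
      using QR0 X disj unfolding F_def by blast
  qed
  \<comment> \<open>The converse direction: splitting lands in
    \<open>Sigma (Pow N) G\<close>.\<close>
  have Fin: "(\<Union>xs\<in>Q. set xs) - D \<subseteq> N \<and> (Q, P - Q) \<in> G ((\<Union>xs\<in>Q. set xs) - D) \<and> Q \<subseteq> P"
    if P: "P \<in> OP" and Q: "Q \<in> F P" for P Q
  proof -
    let ?U = "\<Union>xs\<in>Q. set xs" and ?V = "\<Union>xs\<in>P - Q. set xs"
    have QP: "Q \<subseteq> P" and MD: "M D P \<subseteq> Q" and ME: "Q \<inter> M E P = {}" and cQ: "card Q = m + card D"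
      using Q by (auto simp: F_def)
    have UP: "(\<Union>xs\<in>P. set xs) = D \<union> E \<union> N" and cP: "card P = m + k + card D + card E"
      using P by (auto simp: OP_def ordered_partitions_iff)
    have UV: "?U \<union> ?V = D \<union> E \<union> N"
      using QP UP by blast
    have "?U \<inter> ?V = {}"
      using ordered_partitions_block_unique[OF P[unfolded OP_def]] QP by blast
    moreover have "?U \<inter> E = {}"
      using ME QP by (auto simp: M_def)
    moreover have "?V \<inter> D = {}"
      using MD by (auto simp: M_def)
    \<comment> \<open>Pure set algebra, stated for arbitrary \<open>U\<close> and \<open>V\<close>
      to keep the unions over blocks out of the search. One side covers \<open>D\<close> and a part
      of \<open>N\<close>, the other covers \<open>E\<close> and the rest of
      \<open>N\<close>.\<close>
    moreover have "U - D \<subseteq> N \<and> U = D \<union> (U - D) \<and> V = E \<union> (N - (U - D))"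
      if "U \<union> V = D \<union> E \<union> N" "U \<inter> V = {}" "U \<inter> E = {}" "V \<inter> D = {}" for U V
      using that disj by blast
    ultimately have U: "?U - D \<subseteq> N" "?U = D \<union> (?U - D)" and V: "?V = E \<union> (N - (?U - D))"
      using UV by metis+
    have "card (P - Q) = k + card E"
      using card_Diff_subset[OF finite_subset[OF QP finP[OF P]] QP] cP cQ by simp
    then have "P - Q \<in> ordered_partitions ?V E (k + card E)"
      using ordered_partitions_mono[of P _ _ _ "P - Q" E] P unfolding OP_def by auto
    moreover have "Q \<in> ordered_partitions ?U D (m + card D)"
      using ordered_partitions_mono[of P _ _ _ Q D] P QP cQ unfolding OP_def by auto
    ultimately have "(Q, P - Q) \<in> G (?U - D)"
      by (simp only: G_def mem_Times_iff fst_conv snd_conv U(2)[symmetric] V[symmetric])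
    then show ?thesis
      using U(1) QP by blast
  qed
  have fg: "f (g (X, Q, R)) = (X, Q, R)" if "X \<subseteq> N" "(Q, R) \<in> G X" for X Q R
  proof -
    have "Q \<union> R - Q = R"
      using Gin[OF that] by blast
    then show ?thesis
      using Gin[OF that] by (simp add: f_def g_def)
  qed
  have gf: "g (f (P, Q)) = (P, Q)" if "P \<in> OP" "Q \<in> F P" for P Q
    using Fin[OF that] by (simp add: f_def g_def Un_absorb1)
  have "bij_betw f (Sigma OP F) (Sigma (Pow N) G)"
  proof (rule bij_betw_byWitness[where f' = g])
    show "\<forall>a\<in>Sigma OP F. g (f a) = a"
      using gf by auto
    show "\<forall>a\<in>Sigma (Pow N) G. f (g a) = a"
      using fg by auto
    show "f ` Sigma OP F \<subseteq> Sigma (Pow N) G"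
    proof (rule image_subsetI)
      fix a assume "a \<in> Sigma OP F"
      then obtain P Q where "a = (P, Q)" "P \<in> OP" "Q \<in> F P" by (elim SigmaE)
      then show "f a \<in> Sigma (Pow N) G"
        using Fin[of P Q] by (simp add: f_def)
    qed
    show "g ` Sigma (Pow N) G \<subseteq> Sigma OP F"
    proof (rule image_subsetI)
      fix a assume "a \<in> Sigma (Pow N) G"
      then obtain X Q R where "a = (X, Q, R)" "X \<subseteq> N" "(Q, R) \<in> G X"
        by (metis PowD SigmaE surj_pair)
      then show "g a \<in> Sigma OP F"
        using Gin[of X Q R] by (simp add: g_def)
    qed
  qed
  then have eq: "card (Sigma OP F) = card (Sigma (Pow N) G)"
    by (rule bij_betw_same_card)
  have finOP: "finite OP"
    using fin by (simp add: OP_def finite_ordered_partitions)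
  have "finite (F P)" if "P \<in> OP" for P
    by (rule finite_subset[of _ "Pow P"]) (use finP[OF that] in \<open>auto simp: F_def\<close>)
  then have "card (Sigma OP F) = ((m + k) choose m) * card OP"
    using finOP cardF by (simp add: card_SigmaI)
  moreover have "card (Sigma (Pow N) G) = (\<Sum>X\<in>Pow N. card (G X))"
    using fin by (intro card_SigmaI)
      (auto simp: G_def intro!: finite_cartesian_product finite_ordered_partitions
        intro: finite_subset)
  ultimately show ?thesis
    using eq by (simp add: OP_def G_def card_cartesian_product)
qed

section \<open>The convolution formula\<close>

lemma sum_Pow_card:
  fixes h :: "nat \<Rightarrow> 'b::comm_semiring_1"
  assumes "finite N"
  shows "(\<Sum>X\<in>Pow N. h (card X)) = (\<Sum>l\<le>card N. of_nat (card N choose l) * h l)"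
proof -
  \<comment> \<open>Subsets are grouped by size, on which alone the summand depends.\<close>
  have "(\<Sum>X\<in>Pow N. h (card X)) = (\<Sum>l\<le>card N. \<Sum>X\<in>{X \<in> Pow N. card X = l}. h (card X))"
    by (rule sum.group[symmetric]) (use assms in \<open>auto intro: card_mono\<close>)
  also have "\<dots> = (\<Sum>l\<le>card N. of_nat (card N choose l) * h l)"
    by (rule sum.cong) (use n_subsets[OF assms] in auto)
  finally show ?thesis .
qed

text \<open>The splitting lemma is applied to consecutive intervals of lengths \<open>r\<close>,
  \<open>s\<close> and \<open>n\<close>; each summand then depends on \<open>X\<close> only through
  its size. The two halves may differ in size; the theorem is the case \<open>s = r\<close>.\<close>

lemma r_Lah_convolution:
  "((m + k) choose m) * r_Lah (r + s) n (m + k) =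
    (\<Sum>l\<le>n. (n choose l) * (r_Lah r l m * r_Lah s (n - l) k))"
proof -
  let ?D = "{..<r}" and ?E = "{r..<r + s}" and ?N = "{r + s..<n + (r + s)}"
  have "?D \<union> ?E \<union> ?N = {..<n + (r + s)}" "?D \<union> ?E = {..<r + s}"
    by auto
  then have "((m + k) choose m) * r_Lah (r + s) n (m + k) =
    (\<Sum>X\<in>Pow ?N. card (ordered_partitions (?D \<union> X) ?D (m + card ?D)) *
      card (ordered_partitions (?E \<union> (?N - X)) ?E (k + card ?E)))"
    using card_ordered_partitions_split[of ?D ?E ?N m k]
    by (simp add: r_Lah_def ivl_disj_int disjoint_iff add.assoc)
  also have "\<dots> = (\<Sum>X\<in>Pow ?N. r_Lah r (card X) m * r_Lah s (n - card X) k)"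
  proof (rule sum.cong[OF refl])
    fix X assume "X \<in> Pow ?N"
    then have X: "X \<subseteq> ?N" and "finite X"
      by (auto intro: finite_subset)
    then have "card (?N - X) = n - card X"
      by (simp add: card_Diff_subset)
    moreover have "?D \<inter> X = {}" "?E \<inter> (?N - X) = {}"
      using X by auto
    ultimately show "card (ordered_partitions (?D \<union> X) ?D (m + card ?D)) *
        card (ordered_partitions (?E \<union> (?N - X)) ?E (k + card ?E)) =
        r_Lah r (card X) m * r_Lah s (n - card X) k"
      using \<open>finite X\<close> by (subst (1 2) r_Lah_eq_card_ordered_partitions) auto
  qed
  also have "\<dots> = (\<Sum>l\<le>n. (n choose l) * (r_Lah r l m * r_Lah s (n - l) k))"
    using sum_Pow_card[of ?N "\<lambda>l. r_Lah r l m * r_Lah s (n - l) k"] by simp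
  finally show ?thesis .
qed

theorem theorem10:
  fixes m n k r :: nat
  assumes "m > 0" and "n > 0" and "k > 0" and "n \<ge> m + k"
  shows "((m + k) choose m) * r_Lah (2 * r) n (m + k) =
    (\<Sum>l=m..n - k. (n choose l) * r_Lah r l m * r_Lah r (n - l) k)"
proof -
  have "((m + k) choose m) * r_Lah (2 * r) n (m + k) =
    (\<Sum>l\<le>n. (n choose l) * r_Lah r l m * r_Lah r (n - l) k)"
    using r_Lah_convolution[of m k r r n] by (simp add: mult_2 mult.assoc)
  also have "\<dots> = (\<Sum>l=m..n - k. (n choose l) * r_Lah r l m * r_Lah r (n - l) k)"
  proof (rule sum.mono_neutral_right)
    show "\<forall>l\<in>{..n} - {m..n - k}. (n choose l) * r_Lah r l m * r_Lah r (n - l) k = 0"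
    proof
      fix l assume "l \<in> {..n} - {m..n - k}"
      \<comment> \<open>Outside the range one of the two factors asks for more non-distinguished
        blocks than there are non-distinguished elements, hence vanishes.\<close>
      then have "l < m \<or> n - l < k"
        using assms(4) by auto
      then show "(n choose l) * r_Lah r l m * r_Lah r (n - l) k = 0"
        by (auto simp: r_Lah_eq_0)
    qed
  qed auto
  finally show ?thesis .
qed

end
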